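(* Let $H$ be a simple cycle with at least $5$ vertices. Then $H \in \mathbf{PGR}$, i.e. there is a constant $C_H$ such that $\operatorname{gr}(H,K_k) \le k^{C_H}$ for all integers $k \ge 2$.
   Context: A grid subgraph on $c$ columns and $r$ rows is a graph $H$ whose vertex set is a subset of $[c]\times[r]$ (the vertex $(x,y)$ lies in column $x$ and row $y$) such that every edge joins two vertices in the same row (a horizontal edge) or in the same column (a vertical edge). $G_{c\times r}=K_c\square K_r$ denotes the complete grid graph on $[c]\times[r]$; a spanning grid subgraph is a spanning subgraph of $G_{c\times r}$. An embedding of a grid subgraph $H$ on $c_H$ columns and $r_H$ rows into a grid subgraph $G$ on $c_G$ columns and $r_G$ rows is a pair of injections $\varphi_c:[c_H]\to[c_G]$, $\varphi_r:[r_H]\to[r_G]$ such that for every edge $\{(x,y),(x',y')\}$ of $H$, $\{(\varphi_c(x),\varphi_r(y)),(\varphi_c(x'),\varphi_r(y'))\}$ is an edge of $G$; $G$ contains $H$ if such an embedding exists. A coclique of size $k$ in a spanning grid subgraph $G$ is a set of $k$ vertices all lying in one row or all lying in one column, no two of which are adjacent in $G$. The grid Ramsey number $\operatorname{gr}(H,K_k)$ is the least $N$ such that every spanning grid subgraph of $G_{N\times N}$ contains $H$ or contains a coclique of size $k$. $\mathbf{PGR}$ is the class of grid subgraphs $H$ with $\operatorname{gr}(H,K_k)=k^{O_H(1)}$. A grid subgraph is simple if for every row and every column, the subgraph induced on its vertices lying in that row (resp. column) is connected. A simple cycle is a grid subgraph which is a cycle (as a graph) and is simple; its length is its number of vertices.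 *)

theory Defs
  imports "HOL-Library.Extended_Real"
begin

text \<open>The set of columns is \<open>{1..cols H}\<close>, the set of rows is \<open>{1..rows H}\<close>; the numbers of columns
  and rows are part of the data, as they are not determined by the vertex set. A vertex is a pair
  (column, row); an edge is a two-element set of vertices.\<close>

record grid_graph =
  cols :: nat
  rows :: nat
  verts :: "(nat \<times> nat) set"
  edges :: "(nat \<times> nat) set set"

definition same_line :: "nat \<times> nat \<Rightarrow> nat \<times> nat \<Rightarrow> bool" where
  "same_line u v \<longleftrightarrow> snd u = snd v \<or> fst u = fst v"

definition grid_subgraph :: "grid_graph \<Rightarrow> bool" where
  "grid_subgraph H \<longleftrightarrow>
     verts H \<subseteq> {1..cols H} \<times> {1..rows H} \<and>
     (\<forall>e\<in>edges H. \<exists>u\<in>verts H. \<exists>v\<in>verts H. u \<noteq> v \<and> e = {u, v} \<and> same_line u v)"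

definition complete_grid :: "nat \<Rightarrow> nat \<Rightarrow> grid_graph" where
  "complete_grid c r =
     \<lparr>cols = c, rows = r, verts = {1..c} \<times> {1..r},
      edges = {{u, v} |u v. u \<in> {1..c} \<times> {1..r} \<and> v \<in> {1..c} \<times> {1..r} \<and> u \<noteq> v \<and> same_line u v}\<rparr>"

definition spanning_grid_subgraph :: "nat \<Rightarrow> nat \<Rightarrow> grid_graph \<Rightarrow> bool" where
  "spanning_grid_subgraph c r G \<longleftrightarrow>
     cols G = c \<and> rows G = r \<and> verts G = verts (complete_grid c r) \<and>
     edges G \<subseteq> edges (complete_grid c r)"

definition embedding :: "grid_graph \<Rightarrow> grid_graph \<Rightarrow> (nat \<Rightarrow> nat) \<Rightarrow> (nat \<Rightarrow> nat) \<Rightarrow> bool" where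
  "embedding H G \<phi>c \<phi>r \<longleftrightarrow>
     inj_on \<phi>c {1..cols H} \<and> \<phi>c ` {1..cols H} \<subseteq> {1..cols G} \<and>
     inj_on \<phi>r {1..rows H} \<and> \<phi>r ` {1..rows H} \<subseteq> {1..rows G} \<and>
     (\<forall>x y x' y'. {(x, y), (x', y')} \<in> edges H \<longrightarrow> {(\<phi>c x, \<phi>r y), (\<phi>c x', \<phi>r y')} \<in> edges G)"

definition contains :: "grid_graph \<Rightarrow> grid_graph \<Rightarrow> bool" where
  "contains G H \<longleftrightarrow> (\<exists>\<phi>c \<phi>r. embedding H G \<phi>c \<phi>r)"

definition coclique :: "grid_graph \<Rightarrow> nat \<Rightarrow> (nat \<times> nat) set \<Rightarrow> bool" where
  "coclique G k S \<longleftrightarrow>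
     S \<subseteq> verts G \<and> card S = k \<and>
     ((\<exists>y. \<forall>v\<in>S. snd v = y) \<or> (\<exists>x. \<forall>v\<in>S. fst v = x)) \<and>
     (\<forall>u\<in>S. \<forall>v\<in>S. u \<noteq> v \<longrightarrow> {u, v} \<notin> edges G)"

text \<open>The value is \<open>\<infinity>\<close> if there is no such \<open>N\<close>, so an upper bound on it includes existence.\<close>

definition grid_ramsey :: "grid_graph \<Rightarrow> nat \<Rightarrow> enat" where
  "grid_ramsey H k =
     Inf {enat N |N. \<forall>G. spanning_grid_subgraph N N G \<longrightarrow> contains G H \<or> (\<exists>S. coclique G k S)}"

definition PGR :: "grid_graph set" where
  "PGR = {H. grid_subgraph H \<and>
     (\<exists>C::real. \<forall>k\<ge>2. ereal_of_enat (grid_ramsey H k) \<le> ereal (real k powr C))}"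

definition induced_edges :: "grid_graph \<Rightarrow> (nat \<times> nat) set \<Rightarrow> (nat \<times> nat) set set" where
  "induced_edges H W = {e \<in> edges H. e \<subseteq> W}"

text \<open>The empty graph counts as connected: a row or column without vertices imposes no condition.\<close>

definition connected_graph :: "'a set \<Rightarrow> 'a set set \<Rightarrow> bool" where
  "connected_graph V E \<longleftrightarrow> (\<forall>u\<in>V. \<forall>v\<in>V. (u, v) \<in> {(a, b). {a, b} \<in> E}\<^sup>*)"

definition simple_grid :: "grid_graph \<Rightarrow> bool" where
  "simple_grid H \<longleftrightarrow>
     (\<forall>y\<in>{1..rows H}. let W = {v \<in> verts H. snd v = y} in connected_graph W (induced_edges H W)) \<and>
     (\<forall>x\<in>{1..cols H}. let W = {v \<in> verts H. fst v = x} in connected_graph W (induced_edges H W))"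

definition cycle_graph :: "'a set \<Rightarrow> 'a set set \<Rightarrow> bool" where
  "cycle_graph V E \<longleftrightarrow>
     (\<exists>vs. distinct vs \<and> length vs \<ge> 3 \<and> V = set vs \<and>
           E = {{vs ! i, vs ! (Suc i mod length vs)} |i. i < length vs})"

definition simple_cycle :: "grid_graph \<Rightarrow> bool" where
  "simple_cycle H \<longleftrightarrow> grid_subgraph H \<and> cycle_graph (verts H) (edges H) \<and> simple_grid H"

end

theory Submission
  imports Defs "HOL-Library.Sublist" "HOL-Analysis.Convex"
begin

text \<open>
  Suppose that no row or column of the \<open>N \<times> N\<close> grid contains a coclique of size \<open>k\<close>. If a pattern of
  columns and rows is realised by a proportion \<open>\<epsilon>\<close> of all choices, then it may be enlarged by a
  clone \<open>x'\<close> of any of its columns \<open>x\<close>, where \<open>x'\<close> satisfies the same constraints as \<open>x\<close> and is moreover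
  adjacent to \<open>x\<close> in a prescribed row: by Turan's theorem and the Cauchy--Schwarz inequality the larger
  pattern has proportion at least \<open>\<epsilon>\<^sup>2 / 2k\<close>. Likewise for rows.

  Up to renaming lines, a simple cycle that is not contained in one line is given by its cyclic word
  of horizontal and vertical steps, and cloning a column inserts a horizontal step anywhere in
  the word. Such a word has at least four runs, so, having length at least five, it arises by inserting letters
  into a rotation of \<open>hvhvh\<close> or \<open>vhvhv\<close>, and these are reached from a single point by three clonings.
  For a cycle inside one line, cloning produces a clique.
\<close>

subsection \<open>Counting clones\<close>

text \<open>A weak form of Turan's theorem for ordered pairs, by induction: delete a maximal
  independent set \<open>I\<close>, which has fewer than \<open>k\<close> elements. By maximality
  each remaining vertex has a neighbour in \<open>I\<close> and so accounts for two further ordered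
  pairs.\<close>

lemma card_squared_le_adjacent_pairs:
  fixes R :: "'a \<Rightarrow> 'a \<Rightarrow> bool"
  assumes "finite D" and sym: "\<And>u v. R u v \<Longrightarrow> R v u"
    and no_indep: "\<And>S. S \<subseteq> D \<Longrightarrow> card S = k \<Longrightarrow> \<exists>u\<in>S. \<exists>v\<in>S. u \<noteq> v \<and> R u v"
  shows "(card D)\<^sup>2 \<le> k * (card {(u, v) \<in> D \<times> D. R u v} + card D)"
  using assms(1) no_indep
proof (induction "card D" arbitrary: D rule: less_induct)
  case less
  show ?case
  proof (cases "D = {}")
    case False
    define indep where "indep S \<longleftrightarrow> S \<subseteq> D \<and> (\<forall>u\<in>S. \<forall>v\<in>S. u \<noteq> v \<longrightarrow> \<not> R u v)" for S
    have "finite {S. indep S}"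
      by (rule finite_subset[of _ "Pow D"]) (auto simp: indep_def less.prems)
    moreover have "{} \<in> {S. indep S}" by (simp add: indep_def)
    ultimately obtain I where I: "indep I" and max: "\<And>S. indep S \<Longrightarrow> I \<subseteq> S \<Longrightarrow> S = I"
      using finite_has_maximal[of "{S. indep S}"] by (metis empty_iff mem_Collect_eq)
    have fin: "finite I" using I less.prems(1) finite_subset indep_def by blast
    have "card I < k"
    proof (rule ccontr)
      assume "\<not> card I < k"
      then obtain S where "S \<subseteq> I" "card S = k"
        by (metis fin linorder_not_less obtain_subset_with_card_n)
      then show False using less.prems(2)[of S] I unfolding indep_def by blast
    qed
    have nbr: "\<exists>v\<in>I. R u v" if u: "u \<in> D - I" for u
    proof (rule ccontr)
      assume "\<not> (\<exists>v\<in>I. R u v)"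
      then have "indep (insert u I)" using I u sym unfolding indep_def by blast
      then show False using max u by blast
    qed
    then obtain f where f: "\<And>u. u \<in> D - I \<Longrightarrow> f u \<in> I \<and> R u (f u)" by metis
    have ne: "I \<noteq> {}" using False nbr by fastforce
    have ID: "I \<subseteq> D" using I indep_def by blast
    define D' where "D' = D - I"
    have cd: "card D = card D' + card I" unfolding D'_def
      using ID fin less.prems(1) by (metis card_Diff_subset card_mono le_add_diff_inverse2)
    have "card I > 0" using ne fin by (simp add: card_gt_0_iff)
    then have IH: "(card D')\<^sup>2 \<le> k * (card {(u, v) \<in> D' \<times> D'. R u v} + card D')"
      using less.hyps[of D'] less.prems cd unfolding D'_def by (metis Diff_subset add_diff_cancel_left'
        finite_Diff less_add_same_cancel1 order_trans)
    let ?A = "{(u, v) \<in> D' \<times> D'. R u v}"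
    \<comment> \<open>Both orientations of one chosen edge from each vertex outside \<open>I\<close>
      into \<open>I\<close>; they are disjoint from \<open>?A\<close>, whose pairs avoid
      \<open>I\<close>.\<close>
    let ?B = "(\<lambda>u. (u, f u)) ` D'" and ?C = "(\<lambda>u. (f u, u)) ` D'"
    have finD': "finite D'" using less.prems(1) D'_def by blast
    have "card ?A + card ?B + card ?C = card (?A \<union> ?B \<union> ?C)"
    proof -
      have finA: "finite ?A" by (rule finite_subset[of _ "D' \<times> D'"]) (use finD' in auto)
      have "?A \<inter> ?B = {}" "(?A \<union> ?B) \<inter> ?C = {}" using f unfolding D'_def by auto
      then show ?thesis using finA finD' by (simp add: card_Un_disjoint)
    qed
    moreover have "card ?B = card D'" "card ?C = card D'"
      by (auto intro!: card_image inj_onI)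
    moreover have "card (?A \<union> ?B \<union> ?C) \<le> card {(u, v) \<in> D \<times> D. R u v}"
    proof (rule card_mono)
      show "finite {(u, v) \<in> D \<times> D. R u v}"
        by (rule finite_subset[of _ "D \<times> D"]) (use less.prems in auto)
      show "?A \<union> ?B \<union> ?C \<subseteq> {(u, v) \<in> D \<times> D. R u v}"
        using f sym ID unfolding D'_def by auto
    qed
    ultimately have e: "card ?A + 2 * card D' \<le> card {(u, v) \<in> D \<times> D. R u v}" by linarith
    have "(card D)\<^sup>2 = (card D')\<^sup>2 + 2 * card D' * card I + card I * card I"
      unfolding cd by (simp add: power2_eq_square algebra_simps)
    also have "\<dots> \<le> k * (card ?A + card D') + 2 * card D' * k + card I * k"
      using IH \<open>card I < k\<close> by (intro add_mono mult_left_mono) auto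
    also have "\<dots> = k * (card ?A + 2 * card D' + card D)"
      by (simp add: cd algebra_simps)
    also have "\<dots> \<le> k * (card {(u, v) \<in> D \<times> D. R u v} + card D)"
      using e by (intro mult_left_mono) auto
    finally show ?thesis .
  qed simp
qed

text \<open>Cauchy-Schwarz over the fibres. In the application \<open>R\<close> holds the choices of
  all lines but the one to be cloned, \<open>D\<close> the positions open to that line, and
  \<open>T\<close> the adjacent pairs of such positions.\<close>

lemma card_squared_le_of_fibres:
  fixes D :: "'r \<Rightarrow> 'a set" and T :: "'r \<Rightarrow> ('a \<times> 'a) set"
  assumes "finite R" and "\<And>\<rho>. \<rho> \<in> R \<Longrightarrow> finite (D \<rho>)" and "\<And>\<rho>. \<rho> \<in> R \<Longrightarrow> finite (T \<rho>)"
    and "\<And>\<rho>. \<rho> \<in> R \<Longrightarrow> (card (D \<rho>))\<^sup>2 \<le> k * (card (T \<rho>) + card (D \<rho>))"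
  shows "(card (Sigma R D))\<^sup>2 \<le> card R * (k * (card (Sigma R T) + card (Sigma R D)))"
proof -
  have "real ((\<Sum>\<rho>\<in>R. card (D \<rho>))\<^sup>2) \<le> real (card R * (\<Sum>\<rho>\<in>R. (card (D \<rho>))\<^sup>2))"
    using sum_squared_le_sum_of_squares[of "\<lambda>\<rho>. real (card (D \<rho>))" R] assms(1)
    by (simp add: mult.commute)
  then have "(\<Sum>\<rho>\<in>R. card (D \<rho>))\<^sup>2 \<le> card R * (\<Sum>\<rho>\<in>R. (card (D \<rho>))\<^sup>2)"
    using of_nat_le_iff by blast
  also have "\<dots> \<le> card R * (\<Sum>\<rho>\<in>R. k * (card (T \<rho>) + card (D \<rho>)))"
    using assms(4) by (intro mult_left_mono sum_mono) auto
  finally show ?thesis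
    using assms by (simp add: sum.distrib flip: sum_distrib_left)
qed

text \<open>Here \<open>s\<close> counts realisations and \<open>t\<close> adjacent pairs of them.
  The bound on \<open>N\<close> gives \<open>s \<ge> 2 k N^n\<close>, so the summand with
  \<open>s\<close> on the right of \<open>st\<close> is at most \<open>s^2 / 2\<close>, whence
  \<open>s^2 \<le> 2 k N^n t\<close>. The lower bound on \<open>s\<close> and
  \<open>2 \<le> k\<close> then yield the exponent \<open>2 * C + 2\<close>.\<close>

lemma clone_count_arith:
  fixes N k s t C n :: nat
  assumes k: "2 \<le> k" and N: "k ^ (2 * C + 2) \<le> N" and s: "N ^ Suc n \<le> k ^ C * s"
    and st: "s\<^sup>2 \<le> N ^ n * (k * (t + s))"
  shows "N ^ Suc (Suc n) \<le> k ^ (2 * C + 2) * t"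
proof -
  have kp: "0 < k" using k by simp
  have "0 < k ^ (2 * C + 2)" using kp by simp
  then have Np: "0 < N" using N by linarith
  have "2 * k * k ^ C \<le> k * k * k ^ C" using k by simp
  also have "\<dots> \<le> k ^ (2 * C + 2)"
    using kp power_increasing[of "C + 2" "2 * C + 2" k] by (simp add: power_add power2_eq_square algebra_simps)
  finally have "2 * k * k ^ C \<le> N" using N by linarith
  then have "k ^ C * (2 * k * N ^ n) \<le> N * N ^ n" by (simp add: algebra_simps)
  also have "\<dots> \<le> k ^ C * s" using s by simp
  finally have "2 * (k * N ^ n) \<le> s" using kp by simp
  then have "2 * (k * N ^ n) * s \<le> s * s" by (rule mult_right_mono) simp
  then have "s * s \<le> 2 * (N ^ n * k * t)"
  proof -
    assume "2 * (k * N ^ n) * s \<le> s * s"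
    moreover have "s * s \<le> N ^ n * k * t + k * N ^ n * s"
      using st by (simp add: power2_eq_square algebra_simps)
    ultimately show ?thesis by linarith
  qed
  then have "k ^ (2 * C) * (s * s) \<le> k ^ (2 * C) * (2 * (N ^ n * k * t))"
    by (rule mult_left_mono) simp
  also have "k ^ (2 * C) * (s * s) = (k ^ C * s) * (k ^ C * s)"
    by (simp only: mult_2 power_add mult.assoc mult.left_commute)
  finally have "N ^ Suc n * N ^ Suc n \<le> k ^ (2 * C) * (2 * (N ^ n * k * t))"
    using s mult_mono[OF s s] by linarith
  also have "\<dots> \<le> k ^ (2 * C) * (k * (N ^ n * k * t))"
    using k by (intro mult_left_mono mult_right_mono) auto
  finally have "N ^ n * (N ^ Suc (Suc n)) \<le> N ^ n * (k ^ (2 * C + 2) * t)"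
    by (simp add: power_add power2_eq_square algebra_simps)
  then show ?thesis using Np by simp
qed

section \<open>Patterns and their density\<close>

definition line_system :: "nat \<Rightarrow> nat \<Rightarrow> (nat \<Rightarrow> nat \<Rightarrow> nat \<Rightarrow> bool) \<Rightarrow> bool" where
  "line_system N k E \<longleftrightarrow>
     (\<forall>y u v. E y u v \<longrightarrow> E y v u \<and> u \<noteq> v) \<and>
     (\<forall>y\<in>{1..N}. \<forall>S\<subseteq>{1..N}. card S = k \<longrightarrow> (\<exists>u\<in>S. \<exists>v\<in>S. E y u v))"

lemma line_system_sym: "line_system N k E \<Longrightarrow> E y u v \<Longrightarrow> E y v u"
  and line_system_irrefl: "line_system N k E \<Longrightarrow> E y u v \<Longrightarrow> u \<noteq> v"
  unfolding line_system_def by blast+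

definition lists_in :: "nat \<Rightarrow> nat \<Rightarrow> nat list set" where
  "lists_in N n = {xs. set xs \<subseteq> {1..N} \<and> length xs = n}"

lemma finite_lists_in [simp]: "finite (lists_in N n)"
  and card_lists_in [simp]: "card (lists_in N n) = N ^ n"
  unfolding lists_in_def by (simp_all add: finite_lists_length_eq card_lists_length_eq)

type_synonym pattern =
  "(nat \<Rightarrow> nat \<Rightarrow> nat \<Rightarrow> bool) \<Rightarrow> (nat \<Rightarrow> nat \<Rightarrow> nat \<Rightarrow> bool) \<Rightarrow> nat list \<Rightarrow> nat list \<Rightarrow> bool"

definition solutions :: "pattern \<Rightarrow> nat \<Rightarrow> nat \<Rightarrow> nat \<Rightarrow>
    (nat \<Rightarrow> nat \<Rightarrow> nat \<Rightarrow> bool) \<Rightarrow> (nat \<Rightarrow> nat \<Rightarrow> nat \<Rightarrow> bool) \<Rightarrow> (nat list \<times> nat list) set" where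
  "solutions P p q N E F = {(X, Y) \<in> lists_in N p \<times> lists_in N q. P E F X Y}"

lemma finite_solutions [simp]: "finite (solutions P p q N E F)"
  unfolding solutions_def by (rule finite_subset[of _ "lists_in N p \<times> lists_in N q"]) auto

text \<open>A pattern with \<open>p\<close> columns and \<open>q\<close> rows is dense if a positive proportion, polynomial in \<open>1 / k\<close>,
  of all choices of columns and rows realises it. Here \<open>E y\<close> and \<open>F x\<close> stand for the graphs
  on row \<open>y\<close> and column \<open>x\<close>.\<close>

definition dense :: "pattern \<Rightarrow> nat \<Rightarrow> nat \<Rightarrow> bool" where
  "dense P p q \<longleftrightarrow> (\<exists>C. \<forall>k\<ge>2. \<forall>N\<ge>k ^ C. \<forall>E F. line_system N k E \<longrightarrow> line_system N k F \<longrightarrow>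
     N ^ (p + q) \<le> k ^ C * card (solutions P p q N E F))"

text \<open>Rotating a closed walk permutes its list of columns, so density must be transferred
  along injections of the choices, and not only along implications.\<close>

lemma dense_inj:
  assumes "dense P p q"
    and "\<And>N. inj_on f (lists_in N p \<times> lists_in N q)"
    and "\<And>N E F X Y. X \<in> lists_in N p \<Longrightarrow> Y \<in> lists_in N q \<Longrightarrow> P E F X Y \<Longrightarrow>
      f (X, Y) \<in> solutions Q p q N E F"
  shows "dense Q p q"
proof -
  have "card (solutions P p q N E F) \<le> card (solutions Q p q N E F)" for N E F
  proof (rule card_inj_on_le)
    show "inj_on f (solutions P p q N E F)"
      by (rule inj_on_subset[OF assms(2)[of N]]) (auto simp: solutions_def)
    show "f ` solutions P p q N E F \<subseteq> solutions Q p q N E F"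
    proof (rule image_subsetI)
      fix Z assume "Z \<in> solutions P p q N E F"
      then show "f Z \<in> solutions Q p q N E F"
        using assms(3)[of "fst Z" N "snd Z" E F] by (auto simp: solutions_def)
    qed
  qed simp
  then show ?thesis using assms(1) unfolding dense_def by (meson le_trans mult_le_mono2)
qed

lemma dense_mono:
  assumes "dense P p q"
    and "\<And>E F X Y. length X = p \<Longrightarrow> length Y = q \<Longrightarrow> P E F X Y \<Longrightarrow> Q E F X Y"
  shows "dense Q p q"
  using assms(1) by (rule dense_inj[where f = id]) (auto simp: solutions_def lists_in_def assms(2))

text \<open>Transposition of the grid; thanks to it, cloning need only be proved for
  columns.\<close>

lemma dense_swap:
  assumes "dense P p q"
  shows "dense (\<lambda>E F X Y. P F E Y X) q p"
proof -
  have "card (solutions (\<lambda>E F X Y. P F E Y X) q p N F E) = card (solutions P p q N E F)" for N E F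
    by (rule bij_betw_same_card[of prod.swap])
      (auto simp: bij_betw_def solutions_def inj_on_def image_iff)
  then show ?thesis using assms unfolding dense_def by (metis add.commute)
qed

lemma dense_True: "dense (\<lambda>E F X Y. True) p q"
  unfolding dense_def
proof (intro exI[of _ 0] allI impI)
  fix k N :: nat and E F
  have "solutions (\<lambda>E F X Y. True) p q N E F = lists_in N p \<times> lists_in N q"
    by (auto simp: solutions_def)
  then show "N ^ (p + q) \<le> k ^ 0 * card (solutions (\<lambda>E F X Y. True) p q N E F)"
    by (simp add: card_cartesian_product power_add)
qed

text \<open>\<open>Q\<close> may mix constraints known for \<open>x\<close> with constraints known
  for its clone \<open>x'\<close>, so that a walk can arrive on \<open>x\<close>, cross the new edge
  in row \<open>Y ! b\<close> and continue from \<open>x'\<close>.\<close>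

lemma dense_clone:
  assumes P: "dense P (Suc (a + m)) q" and b: "b < q"
    and Q: "\<And>E F X1 x x' X2 Y. length X1 = a \<Longrightarrow> length X2 = m \<Longrightarrow> length Y = q \<Longrightarrow>
      P E F (X1 @ x # X2) Y \<Longrightarrow> P E F (X1 @ x' # X2) Y \<Longrightarrow> E (Y ! b) x x' \<Longrightarrow> E (Y ! b) x' x \<Longrightarrow>
      x \<noteq> x' \<Longrightarrow> Q E F (X1 @ x # x' # X2) Y"
  shows "dense Q (Suc (Suc (a + m))) q"
proof -
  obtain C where C: "\<And>k N E F. 2 \<le> k \<Longrightarrow> k ^ C \<le> N \<Longrightarrow> line_system N k E \<Longrightarrow> line_system N k F \<Longrightarrow>
     N ^ (Suc (a + m) + q) \<le> k ^ C * card (solutions P (Suc (a + m)) q N E F)"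
    using P unfolding dense_def by blast
  have "N ^ (Suc (Suc (a + m)) + q) \<le> k ^ (2 * C + 2) * card (solutions Q (Suc (Suc (a + m))) q N E F)"
    if k: "2 \<le> k" and N: "k ^ (2 * C + 2) \<le> N" and E: "line_system N k E" and F: "line_system N k F"
    for k N E F
  proof -
    define R where "R = lists_in N a \<times> lists_in N m \<times> lists_in N q"
    define D where "D = (\<lambda>(X1, X2, Y). {x \<in> {1..N}. P E F (X1 @ x # X2) Y})"
    define T where "T \<rho> = {(x, x') \<in> D \<rho> \<times> D \<rho>. E (snd (snd \<rho>) ! b) x x'}" for \<rho>
    have finD: "finite (D \<rho>)" for \<rho> unfolding D_def by (cases \<rho>) auto
    have finT: "finite (T \<rho>)" for \<rho>
      by (rule finite_subset[of _ "D \<rho> \<times> D \<rho>"]) (auto simp: T_def finD)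
    have cR: "card R = N ^ (a + m + q)" by (simp add: R_def card_cartesian_product power_add)
    have finR: "finite R" unfolding R_def by simp
    have loc: "(card (D \<rho>))\<^sup>2 \<le> k * (card (T \<rho>) + card (D \<rho>))" if \<rho>: "\<rho> \<in> R" for \<rho>
      unfolding T_def
    proof (rule card_squared_le_adjacent_pairs)
      obtain X1 X2 Y where r: "\<rho> = (X1, X2, Y)" by (cases \<rho>)
      have y: "Y ! b \<in> {1..N}" using \<rho> b unfolding R_def r lists_in_def by force
      fix S assume S: "S \<subseteq> D \<rho>" "card S = k"
      have "S \<subseteq> {1..N}" using S(1) unfolding D_def r by auto
      then show "\<exists>u\<in>S. \<exists>v\<in>S. u \<noteq> v \<and> E (snd (snd \<rho>) ! b) u v"
        using E S(2) y unfolding line_system_def r snd_conv by metis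
    qed (use finD E line_system_def in auto)
    \<comment> \<open>Each realisation splits at position \<open>a\<close> into a choice of the
      other lines and a point of its fibre.\<close>
    have "card (solutions P (Suc (a + m)) q N E F) \<le> card (Sigma R D)"
    proof (rule surj_card_le)
      show "solutions P (Suc (a + m)) q N E F \<subseteq> (\<lambda>((X1, X2, Y), x). (X1 @ x # X2, Y)) ` Sigma R D"
      proof clarify
        fix X Y assume "(X, Y) \<in> solutions P (Suc (a + m)) q N E F"
        then have X: "set X \<subseteq> {1..N}" "length X = Suc (a + m)" and Y: "Y \<in> lists_in N q" and P: "P E F X Y"
          by (auto simp: solutions_def lists_in_def)
        have split: "X = take a X @ X ! a # drop (Suc a) X"
          using X(2) by (simp add: id_take_nth_drop)
        have "take a X \<in> lists_in N a" "drop (Suc a) X \<in> lists_in N m" "X ! a \<in> {1..N}"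
          using X set_take_subset[of a X] set_drop_subset[of "Suc a" X]
          by (fastforce simp: lists_in_def)+
        then have "((take a X, drop (Suc a) X, Y), X ! a) \<in> Sigma R D"
          using Y P split by (simp add: R_def D_def)
        then show "(X, Y) \<in> (\<lambda>((X1, X2, Y), x). (X1 @ x # X2, Y)) ` Sigma R D"
          using split by (intro image_eqI) auto
      qed
    qed (use finR finD in auto)
    then have "N ^ (Suc (a + m) + q) \<le> k ^ C * card (Sigma R D)"
    proof -
      have "k ^ C \<le> k ^ (2 * C + 2)" using k by (intro power_increasing) auto
      then have "k ^ C \<le> N" using N by linarith
      then have "N ^ (Suc (a + m) + q) \<le> k ^ C * card (solutions P (Suc (a + m)) q N E F)"
        using C k E F by blast
      also assume "card (solutions P (Suc (a + m)) q N E F) \<le> card (Sigma R D)"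
      finally show ?thesis by simp
    qed
    moreover have "(card (Sigma R D))\<^sup>2 \<le> N ^ (a + m + q) * (k * (card (Sigma R T) + card (Sigma R D)))"
      using card_squared_le_of_fibres[of R D T k] finR finD finT loc unfolding cR by blast
    ultimately have "N ^ Suc (Suc (a + m + q)) \<le> k ^ (2 * C + 2) * card (Sigma R T)"
      using clone_count_arith[OF k N, of "a + m + q"] by simp
    also have "card (Sigma R T) \<le> card (solutions Q (Suc (Suc (a + m))) q N E F)"
    proof (rule card_inj_on_le)
      let ?f = "\<lambda>((X1, X2, Y), x, x'). (X1 @ x # x' # X2, Y)"
      show "inj_on ?f (Sigma R T)"
      proof (rule inj_onI)
        fix Z Z' assume Z: "Z \<in> Sigma R T" "Z' \<in> Sigma R T" and eq: "?f Z = ?f Z'"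
        obtain X1 X2 Y x x' where Z1: "Z = ((X1, X2, Y), x, x')" by (cases Z) auto
        obtain X1' X2' Y' u u' where Z2: "Z' = ((X1', X2', Y'), u, u')" by (cases Z') auto
        \<comment> \<open>The fixed length of the prefix makes the decomposition of the enlarged
          list unique.\<close>
        have "length X1 = length X1'" using Z by (auto simp: Z1 Z2 R_def lists_in_def)
        then show "Z = Z'" using eq by (simp add: Z1 Z2)
      qed
      show "?f ` Sigma R T \<subseteq> solutions Q (Suc (Suc (a + m))) q N E F"
      proof (rule image_subsetI)
        fix Z assume "Z \<in> Sigma R T"
        then obtain X1 X2 Y x x' where Z: "Z = ((X1, X2, Y), x, x')"
          and r: "(X1, X2, Y) \<in> R" and t: "(x, x') \<in> T (X1, X2, Y)" by auto
        have "E (Y ! b) x x'" using t by (simp add: T_def)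
        moreover from line_system_sym[OF E this] line_system_irrefl[OF E this]
        have "E (Y ! b) x' x" "x \<noteq> x'" .
        ultimately have "Q E F (X1 @ x # x' # X2) Y"
          using r t by (intro Q) (auto simp: R_def lists_in_def T_def D_def)
        then show "?f Z \<in> solutions Q (Suc (Suc (a + m))) q N E F"
          using r t by (auto simp: Z R_def lists_in_def T_def D_def solutions_def)
      qed
    qed simp
    finally show ?thesis by simp
  qed
  note main = this
  show ?thesis unfolding dense_def
    by (rule exI[of _ "2 * C + 2"], intro allI impI, rule main)
qed

subsection \<open>Closed walks\<close>

text \<open>A word is a list of steps, \<open>True\<close> for horizontal and \<open>False\<close> for vertical. The lists \<open>L\<close> and \<open>M\<close>
  are the successive columns and rows visited, so that each step consumes one element of one of them.\<close>

primrec walk :: "(nat \<Rightarrow> nat \<Rightarrow> nat \<Rightarrow> bool) \<Rightarrow> (nat \<Rightarrow> nat \<Rightarrow> nat \<Rightarrow> bool) \<Rightarrow>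
    bool list \<Rightarrow> nat list \<Rightarrow> nat list \<Rightarrow> bool" where
  "walk E F [] L M \<longleftrightarrow> True"
| "walk E F (h # w) L M \<longleftrightarrow>
     (if h then E (M ! 0) (L ! 0) (L ! 1) \<and> walk E F w (tl L) M
      else F (L ! 0) (M ! 0) (M ! 1) \<and> walk E F w L (tl M))"

abbreviation "hsteps \<equiv> \<lambda>w. count_list w True"
abbreviation "vsteps \<equiv> \<lambda>w. count_list w False"

lemma walk_append:
  "walk E F (w1 @ w2) L M \<longleftrightarrow> walk E F w1 L M \<and> walk E F w2 (drop (hsteps w1) L) (drop (vsteps w1) M)"
  by (induction w1 arbitrary: L M) (auto simp: drop_Suc)

text \<open>A walk along \<open>w\<close> reads no entry of the column list beyond the index
  \<open>hsteps w\<close>.\<close>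

lemma walk_take:
  assumes "hsteps w < length L" 
  shows "walk E F w (L @ L') M \<longleftrightarrow> walk E F w L M"
  using assms
proof (induction w arbitrary: L M)
  case (Cons h w)
  then obtain x L1 where L: "L = x # L1" by (cases L) auto
  show ?case
  proof (cases h)
    case True
    then show ?thesis using Cons.IH[of L1 M] Cons.prems L by (auto simp: nth_append)
  next
    case False
    then show ?thesis using Cons.IH[of L "tl M"] Cons.prems L by auto
  qed
qed simp

lemma walk_swap: "walk E F (map Not w) L M \<longleftrightarrow> walk F E w M L"
  by (induction w arbitrary: L M) auto

text \<open>The return to the first column and row is not stored in \<open>X\<close> and
  \<open>Y\<close> but appended. For a word without steps of one kind the corresponding list is
  empty and its \<open>hd\<close> unspecified; hence the positivity assumptions below.\<close>

definition closed_walk :: "bool list \<Rightarrow> pattern" where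
  "closed_walk w E F X Y \<longleftrightarrow>
     distinct X \<and> distinct Y \<and> walk E F w (X @ [hd X]) (Y @ [hd Y])"

definition dense_word :: "bool list \<Rightarrow> bool" where
  "dense_word w \<longleftrightarrow> dense (closed_walk w) (hsteps w) (vsteps w)"

lemma count_map_Not: "hsteps (map Not w) = vsteps w" "vsteps (map Not w) = hsteps w"
  by (induction w) auto

lemma dense_word_swap:
  assumes "dense_word w"
  shows "dense_word (map Not w)"
proof -
  have "closed_walk (map Not w) = (\<lambda>E F X Y. closed_walk w F E Y X)"
    by (intro ext) (auto simp: closed_walk_def walk_swap)
  then show ?thesis
    using dense_swap[of "closed_walk w"] assms unfolding dense_word_def by (simp add: count_map_Not)
qed

text \<open>Moving the starting point along a horizontal first step rotates the columns and leaves
  the rows as they are.\<close>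

lemma dense_word_rotate_horizontal:
  assumes "dense_word (True # w)" and "0 < vsteps w"
  shows "dense_word (w @ [True])"
proof -
  have "dense (closed_walk (w @ [True])) (hsteps (True # w)) (vsteps w)"
  proof (rule dense_inj[where f = "\<lambda>(X, Y). (rotate1 X, Y)"])
    show "dense (closed_walk (True # w)) (hsteps (True # w)) (vsteps w)"
      using assms(1) by (simp add: dense_word_def)
    show "inj_on (\<lambda>(X, Y). (rotate1 X, Y)) (lists_in N (hsteps (True # w)) \<times> lists_in N (vsteps w))" for N
      using inj_rotate1 by (auto simp: inj_on_def)
    fix N E F X Y
    assume X: "X \<in> lists_in N (hsteps (True # w))" and Y: "Y \<in> lists_in N (vsteps w)"
      and c: "closed_walk (True # w) E F X Y"
    obtain x X' where X': "X = x # X'" "length X' = hsteps w"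
      using X by (cases X) (auto simp: lists_in_def)
    obtain y Y' where Y': "Y = y # Y'" using Y assms(2) by (cases Y) (auto simp: lists_in_def)
    have lY: "length Y = vsteps w" using Y by (simp add: lists_in_def)
    \<comment> \<open>After \<open>w\<close> all of \<open>X'\<close> and \<open>Y\<close> has been
      consumed, so the final step leads from \<open>x\<close> to the first column of the rotated
      list in the first row: it is the former first step.\<close>
    have d: "drop (hsteps w) (X' @ x # L) = x # L" for L using X' by simp
    have e: "drop (vsteps w) (Y @ M) = M" for M using lY by simp
    have "closed_walk (w @ [True]) E F (rotate1 X) Y"
      using c X' e walk_take[of w "X' @ [x]" E F "[hd (X' @ [x])]" "Y @ [hd Y]"]
      by (simp add: closed_walk_def walk_append d Y' del: append.simps)
        (auto simp: d hd_conv_nth nth_append)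
    then show "(\<lambda>(X, Y). (rotate1 X, Y)) (X, Y) \<in> solutions (closed_walk (w @ [True])) (hsteps (True # w)) (vsteps w) N E F"
      using X Y by (simp add: solutions_def lists_in_def)
  qed
  then show ?thesis by (simp add: dense_word_def)
qed

lemma dense_word_rotate1:
  assumes "dense_word w" and "0 < hsteps w" and "0 < vsteps w"
  shows "dense_word (rotate1 w)"
proof (cases w)
  case (Cons h w')
  show ?thesis
  proof (cases h)
    case True
    then show ?thesis using Cons assms dense_word_rotate_horizontal[of w'] by simp
  next
    case False
    then have "dense_word (map Not w' @ [True])"
      using Cons assms dense_word_swap[of w] by (intro dense_word_rotate_horizontal) (auto simp: count_map_Not)
    from dense_word_swap[OF this] show ?thesis using Cons False by (simp add: o_def)
  qed
qed (use assms in simp)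

lemma dense_word_rotate:
  assumes "dense_word (u @ v)" and "0 < hsteps (u @ v)" and "0 < vsteps (u @ v)"
  shows "dense_word (v @ u)"
  using assms
proof (induction u arbitrary: v)
  case (Cons h u)
  then have "dense_word (u @ (v @ [h]))" using dense_word_rotate1[of "(h # u) @ v"] by simp
  then show ?case using Cons.IH[of "v @ [h]"] Cons.prems by (simp split: if_splits)
qed simp

text \<open>The clone of a column takes over the part of the cycle after the insertion point. This needs
  the run of vertical steps in that column to be a proper arc, and not to pass through the starting
  point of the closed walk; rotation takes care of the latter.\<close>

lemma dense_word_insert_inner:
  assumes "dense_word (w1 @ w2)" and "0 < hsteps w1" and "0 < hsteps w2" and "0 < vsteps (w1 @ w2)"
  shows "dense_word (w1 @ True # w2)"
proof -
  define a m q where "a = hsteps w1" and "m = hsteps w2 - 1" and "q = vsteps (w1 @ w2)"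
  \<comment> \<open>The position in \<open>Y\<close> of the row at the insertion point. If all
    vertical steps come earlier, this row is the appended copy of the first one, so the position is
    0.\<close>
  define b where "b = (if vsteps w1 < q then vsteps w1 else 0)"
  have b: "b < q" using assms(4) unfolding b_def q_def by presburger
  have row: "(Y @ [hd Y]) ! vsteps w1 = Y ! b" if "length Y = q" for Y :: "nat list"
  proof (cases "vsteps w1 < q")
    case False
    then have "vsteps w1 = q" by (simp add: q_def)
    then show ?thesis using that b by (cases Y) (auto simp: b_def nth_append)
  qed (use that in \<open>simp add: b_def nth_append\<close>)
  have "dense (closed_walk (w1 @ True # w2)) (Suc (Suc (a + m))) q"
  proof (rule dense_clone[OF _ b])
    show "dense (closed_walk (w1 @ w2)) (Suc (a + m)) q"
      using assms by (simp add: dense_word_def a_def m_def q_def)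
    fix E F :: "nat \<Rightarrow> nat \<Rightarrow> nat \<Rightarrow> bool" and X1 x x' X2 Y
    assume l: "length X1 = a" "length X2 = m" "length Y = q"
      and c: "closed_walk (w1 @ w2) E F (X1 @ x # X2) Y" "closed_walk (w1 @ w2) E F (X1 @ x' # X2) Y"
      and adj: "E (Y ! b) x x'" "x \<noteq> x'"
    \<comment> \<open>As \<open>x\<close> is not the first column, replacing it by \<open>x'\<close>
      does not affect the column that closes the walk.\<close>
    have X1: "X1 \<noteq> []" using l assms(2) by (auto simp: a_def)
    let ?M = "Y @ [hd Y]"
    have w1: "walk E F w1 (X1 @ x # L) ?M \<longleftrightarrow> walk E F w1 (X1 @ [x]) ?M" for L
      using walk_take[of w1 "X1 @ [x]" E F L ?M] l by (simp add: a_def)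
    have "vsteps w1 < length ?M" using l by (simp add: q_def)
    then have "drop (vsteps w1) ?M ! 0 = Y ! b" using row l by (simp del: drop_append)
    then show "closed_walk (w1 @ True # w2) E F (X1 @ x # x' # X2) Y"
      using c adj l X1 w1 by (simp add: closed_walk_def walk_append a_def) auto
  qed
  then show ?thesis using assms by (simp add: dense_word_def a_def m_def q_def)
qed

lemma split_two_hsteps:
  assumes "2 \<le> hsteps w"
  obtains u v where "w = u @ v" and "0 < hsteps u" and "0 < hsteps v"
proof -
  have "True \<in> set w" using assms by (cases "True \<in> set w") auto
  then obtain u v where "w = u @ True # v" "True \<notin> set u" by (meson split_list_first)
  then show ?thesis using assms that[of "u @ [True]" v] by simp
qed

text \<open>If all horizontal steps lie on one side of the insertion point, the column to be cloned
  is the starting one. The word is then cut between two horizontal steps, rotated to start there,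
  enlarged, and rotated back.\<close>

lemma dense_word_insert_horizontal:
  assumes "dense_word (w1 @ w2)" and h: "2 \<le> hsteps (w1 @ w2)" and v: "0 < vsteps (w1 @ w2)"
  shows "dense_word (w1 @ True # w2)"
proof -
  consider "0 < hsteps w1" "0 < hsteps w2" | "hsteps w1 = 0" | "hsteps w2 = 0" by linarith
  then show ?thesis
  proof cases
    case 1
    then show ?thesis using assms by (intro dense_word_insert_inner)
  next
    case 2
    with h have "2 \<le> hsteps w2" by simp
    then obtain u t where w2: "w2 = u @ t" "0 < hsteps u" "0 < hsteps t" by (rule split_two_hsteps)
    have "dense_word (t @ w1 @ u)" using dense_word_rotate[of "w1 @ u" t] assms w2 by simp
    then have "dense_word ((t @ w1) @ True # u)" using w2 v by (intro dense_word_insert_inner) auto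
    then show ?thesis using dense_word_rotate[of t "w1 @ True # u"] w2 v by auto
  next
    case 3
    with h have "2 \<le> hsteps w1" by simp
    then obtain u t where w1: "w1 = u @ t" "0 < hsteps u" "0 < hsteps t" by (rule split_two_hsteps)
    have "dense_word ((t @ w2) @ u)" using dense_word_rotate[of u "t @ w2"] assms w1 by simp
    then have "dense_word (t @ True # (w2 @ u))" using w1 v by (intro dense_word_insert_inner) auto
    then show ?thesis using dense_word_rotate[of "t @ True # w2" u] w1 v by auto
  qed
qed

lemma dense_word_insert:
  assumes "dense_word (w1 @ w2)" and "2 \<le> hsteps (w1 @ w2)" and "2 \<le> vsteps (w1 @ w2)"
  shows "dense_word (w1 @ h # w2)"
proof (cases h)
  case True
  have "0 < vsteps (w1 @ w2)" using assms(3) by linarith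
  with True show ?thesis using dense_word_insert_horizontal[OF assms(1,2)] by simp
next
  case False
  have "dense_word (map Not w1 @ True # map Not w2)"
    using dense_word_swap[OF assms(1)] assms(2,3)
    by (intro dense_word_insert_horizontal) (auto simp: count_map_Not)
  from dense_word_swap[OF this] False show ?thesis by (simp add: o_def)
qed

text \<open>Columns \<open>z, x, x'\<close> and rows \<open>y, y'\<close>: clone a row of a single point to get \<open>y, y'\<close>, then the column
  in row \<open>y\<close> to get \<open>z\<close> and \<open>x\<close>, and finally \<open>x\<close> in row \<open>y'\<close> to get \<open>x'\<close>. The four-cycle \<open>hvhv\<close> is
  not reachable, since the two columns of a rectangle have to be adjacent in two rows at once.\<close>

lemma dense_word_base: "dense_word [True, False, True, False, True]"
proof -
  define P1 :: pattern where
    "P1 = (\<lambda>E F X Y. E (Y ! 0) (X ! 0) (X ! 1) \<and> E (Y ! 0) (X ! 1) (X ! 0) \<and> distinct X)"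
  \<comment> \<open>The column \<open>X ! 1\<close> carries the edge between the two rows, while
    \<open>X ! 0\<close> is only its neighbour in the first row.\<close>
  define P2 :: pattern where
    "P2 = (\<lambda>E F X Y. P1 F E Y [X ! 1] \<and> E (Y ! 0) (X ! 0) (X ! 1) \<and> E (Y ! 0) (X ! 1) (X ! 0) \<and> distinct X)"
  have "dense P1 (Suc (Suc (0 + 0))) 1"
    by (rule dense_clone[where P = "\<lambda>E F X Y. True" and b = 0])
      (auto simp: dense_True P1_def)
  from dense_swap[OF this]
  have 1: "dense (\<lambda>E F X Y. P1 F E Y X) (Suc (0 + 0)) 2" by (simp add: numeral_2_eq_2)
  have 2: "dense P2 (Suc (1 + 0)) 2"
    using dense_clone[OF 1, of 0 P2] by (simp add: P2_def P1_def)
  have "dense (closed_walk [True, False, True, False, True]) (Suc (Suc (1 + 0))) 2"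
  proof (rule dense_clone[OF 2, of 1])
    fix E F :: "nat \<Rightarrow> nat \<Rightarrow> nat \<Rightarrow> bool" and X1 X2 Y :: "nat list" and x x'
    assume l: "length X1 = 1" "length X2 = 0" "length Y = 2"
    obtain z where "X1 = [z]" using l(1) by (auto simp: length_Suc_conv)
    moreover obtain y y' where "Y = [y, y']" using l(3) by (auto simp: length_Suc_conv numeral_2_eq_2)
    moreover assume "P2 E F (X1 @ x # X2) Y" "P2 E F (X1 @ x' # X2) Y"
      "E (Y ! 1) x x'" "E (Y ! 1) x' x" "x \<noteq> x'"
    \<comment> \<open>The cycle runs from \<open>z\<close> to \<open>x\<close> in row
      \<open>y\<close>, to \<open>y'\<close> in column \<open>x\<close>, to \<open>x'\<close> in row
      \<open>y'\<close>, back to \<open>y\<close> in column \<open>x'\<close>, and to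
      \<open>z\<close> by the adjacency that \<open>x'\<close> inherits from
      \<open>x\<close>.\<close>
    ultimately show "closed_walk [True, False, True, False, True] E F (X1 @ x # x' # X2) Y"
      using l(2) by (auto simp: P2_def P1_def closed_walk_def)
  qed simp
  then show ?thesis by (simp add: dense_word_def numeral_2_eq_2 numeral_3_eq_3)
qed

section \<open>Words with four alternating letters, and words with few runs\<close>

lemma subseq_delete:
  assumes "subseq u w" and "length u < length w"
  obtains w1 l w2 where "w = w1 @ l # w2" and "subseq u (w1 @ w2)"
  using assms
proof (induction arbitrary: thesis rule: list_emb.induct)
  case (list_emb_Nil ys)
  then show ?case by (cases ys) (auto intro: list_emb_Nil.prems(1)[of "[]"])
next
  case (list_emb_Cons xs ys y)
  then show ?case using list_emb_Cons.prems(1)[of "[]" y ys] by simp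
next
  case (list_emb_Cons2 x y xs ys)
  from list_emb_Cons2.prems(2) obtain w1 l w2 where "ys = w1 @ l # w2" "subseq xs (w1 @ w2)"
    using list_emb_Cons2.IH by auto
  then show ?case using list_emb_Cons2.prems(1)[of "y # w1" l w2] list_emb_Cons2.hyps by simp
qed

lemma count_list_subseq_le: "subseq u w \<Longrightarrow> count_list u x \<le> count_list w x"
  by (induction rule: list_emb.induct) auto

text \<open>A longer word has a letter outside the given subsequence; deleting it keeps two steps of
  each kind, and insertion restores it. The induction stops at length five.\<close>

lemma dense_word_of_alternating:
  assumes "subseq [True, False, True, False] w" and "5 \<le> length w"
  shows "dense_word w"
  using assms
proof (induction "length w" arbitrary: w rule: less_induct)
  case less
  obtain w1 h w2 where w: "w = w1 @ h # w2" and sub: "subseq [True, False, True, False] (w1 @ w2)"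
    by (rule subseq_delete[OF less.prems(1)]) (use less.prems(2) in auto)
  show ?case
  proof (cases "length w = 5")
    case False
    then have "dense_word (w1 @ w2)" using less.hyps[of "w1 @ w2"] less.prems(2) sub w by simp
    moreover have "2 \<le> hsteps (w1 @ w2)" "2 \<le> vsteps (w1 @ w2)"
      using count_list_subseq_le[OF sub, of True] count_list_subseq_le[OF sub, of False] by simp_all
    ultimately show ?thesis using dense_word_insert w by blast
  next
    case True
    then have eq: "w1 @ w2 = [True, False, True, False]"
      using subseq_same_length[OF sub] w by simp
    let ?T = "True" and ?F = "False"
    have r: "dense_word (rotate1 u)" if "dense_word u" "0 < hsteps u" "0 < vsteps u" for u
      using that by (rule dense_word_rotate1)
    note h0 = dense_word_base
    have h1: "dense_word [?F, ?T, ?F, ?T, ?T]" using r[OF h0] by simp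
    have h2: "dense_word [?T, ?F, ?T, ?T, ?F]" using r[OF h1] by simp
    have h3: "dense_word [?F, ?T, ?T, ?F, ?T]" using r[OF h2] by simp
    have h4: "dense_word [?T, ?T, ?F, ?T, ?F]" using r[OF h3] by simp
    note v = dense_word_swap[OF h0] dense_word_swap[OF h1] dense_word_swap[OF h2]
      dense_word_swap[OF h3] dense_word_swap[OF h4]
    show ?thesis
      using eq w h0 h1 h2 h3 h4 v
      by (cases h) (auto simp: append_eq_Cons_conv)
  qed
qed

lemma dense_word_of_alternating':
  assumes "subseq [h, \<not> h, h, \<not> h] w" and "5 \<le> length w"
  shows "dense_word w"
proof (cases h)
  case True
  then show ?thesis using assms dense_word_of_alternating by simp
next
  case False
  then have "subseq (map Not [h, \<not> h, h, \<not> h]) (map Not w)" using assms(1) subseq_map by blast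
  then have "dense_word (map Not w)" using False assms(2) by (intro dense_word_of_alternating) auto
  from dense_word_swap[OF this] show ?thesis by (simp add: o_def)
qed

text \<open>Read cyclically, the first and last of the three runs merge, so the second alternative
  covers the cyclic words with at most two runs.\<close>

lemma alternating_or_three_runs:
  fixes w :: "bool list"
  obtains h where "subseq [h, \<not> h, h, \<not> h] w"
  | h a b c where "w = replicate a h @ replicate b (\<not> h) @ replicate c h"
proof -
  have "(\<exists>h. subseq [h, \<not> h, h, \<not> h] w) \<or>
    (\<exists>h a b c. w = replicate a h @ replicate b (\<not> h) @ replicate c h)"
  proof (induction w)
    case Nil
    have "[] = replicate 0 True @ replicate 0 (\<not> True) @ replicate 0 True" by simp
    then show ?case by blast
  next
    case (Cons g w)
    then consider h where "subseq [h, \<not> h, h, \<not> h] w"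
      | h a b c where "w = replicate a h @ replicate b (\<not> h) @ replicate c h" by blast
    then show ?case
    proof cases
      case 1
      then show ?thesis by (meson list_emb_Cons)
    next
      case (2 h a b c)
      consider "g = h" | "g = (\<not> h)" "a = 0" | "g = (\<not> h)" "b = 0" | "g = (\<not> h)" "c = 0"
        | a' b' c' where "g = (\<not> h)" "a = Suc a'" "b = Suc b'" "c = Suc c'"
        by (metis not0_implies_Suc)
      then show ?thesis
      proof cases
        case 1
        with 2 have "g # w = replicate (Suc a) h @ replicate b (\<not> h) @ replicate c h" by simp
        then show ?thesis by blast
      next
        case ll: 2
        with 2 have "g # w = replicate (Suc b) g @ replicate c (\<not> g) @ replicate 0 g" by simp
        then show ?thesis by blast
      next
        case 3
        with 2 have "g # w = replicate 1 g @ replicate (a + c) (\<not> g) @ replicate 0 g"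
          by (simp add: replicate_add)
        then show ?thesis by blast
      next
        case 4
        with 2 have "g # w = replicate 1 g @ replicate a (\<not> g) @ replicate b g" by simp
        then show ?thesis by blast
      next
        case 5
        \<comment> \<open>All three runs are nonempty, so the new letter opens a fourth.\<close>
        have "subseq [\<not> g, g, \<not> g] w"
        proof -
          have "subseq ([h] @ [\<not> h] @ [h]) w" unfolding 2
            using 5 by (intro list_emb_append_mono) auto
          then show ?thesis using 5 by simp
        qed
        then have "subseq [g, \<not> g, g, \<not> g] (g # w)" by simp
        then show ?thesis by blast
      qed
    qed
  qed
  then show thesis using that by blast
qed

text \<open>Cloning the first column in the only row enlarges a clique by one vertex, since the
  clone inherits all adjacencies. \<open>sorted_wrt\<close> records each pair in list order only;
  symmetry of \<open>E\<close> supplies the other order.\<close>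

lemma dense_clique: "dense (\<lambda>E F X Y. sorted_wrt (E (Y ! 0)) X \<and> distinct X) (Suc n) 1"
proof (induction n)
  case 0
  show ?case
    by (rule dense_mono[OF dense_True]) (auto simp: length_Suc_conv)
next
  case (Suc n)
  show ?case
    using dense_clone[where a = 0 and m = n and q = 1 and b = 0, 
        where P = "\<lambda>E F X Y. sorted_wrt (E (Y ! 0)) X \<and> distinct X"
          and Q = "\<lambda>E F X Y. sorted_wrt (E (Y ! 0)) X \<and> distinct X"] Suc
    by auto
qed

subsection \<open>Embeddings\<close>

text \<open>An embedding has to place every line in the range of \<open>H\<close>, even lines
  without vertices, whereas a pattern only places lines that meet \<open>H\<close>.\<close>

lemma inj_on_extend:
  assumes "finite A" "finite B" "A' \<subseteq> A" "inj_on f A'" "f ` A' \<subseteq> B" "card A \<le> card B"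
  obtains g where "inj_on g A" "g ` A \<subseteq> B" "\<And>a. a \<in> A' \<Longrightarrow> g a = f a"
proof -
  have "card (A - A') \<le> card (B - f ` A')"
    using assms by (simp add: card_Diff_subset finite_subset card_image)
  then obtain h where h: "h ` (A - A') \<subseteq> B - f ` A'" "inj_on h (A - A')"
    using card_le_inj[of "A - A'" "B - f ` A'"] assms by auto
  let ?g = "\<lambda>a. if a \<in> A' then f a else h a"
  have "inj_on ?g A"
    using h assms(4) by (auto simp: inj_on_def)
  moreover have "?g ` A \<subseteq> B" using h assms(3,5) by auto
  ultimately show thesis using that by simp
qed

text \<open>In a grid without cocliques of size \<open>k\<close> the rows and columns form line
  systems, and the density bound is positive, so some realisation exists; \<open>emb\<close> turns
  it into a placement of the lines of \<open>H\<close>.\<close>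

lemma PGR_of_dense:
  assumes H: "grid_subgraph H" and P: "dense P p q"
    and emb: "\<And>E F X Y. \<lbrakk>\<And>y u v. E y u v \<Longrightarrow> E y v u; \<And>x u v. F x u v \<Longrightarrow> F x v u;
        length X = p; length Y = q; P E F X Y\<rbrakk> \<Longrightarrow>
      \<exists>\<phi> \<psi>. inj_on \<phi> (fst ` verts H) \<and> \<phi> ` fst ` verts H \<subseteq> set X \<and>
        inj_on \<psi> (snd ` verts H) \<and> \<psi> ` snd ` verts H \<subseteq> set Y \<and>
        (\<forall>x x' y. {(x, y), (x', y)} \<in> edges H \<longrightarrow> x \<noteq> x' \<longrightarrow> E (\<psi> y) (\<phi> x) (\<phi> x')) \<and>
        (\<forall>x y y'. {(x, y), (x, y')} \<in> edges H \<longrightarrow> y \<noteq> y' \<longrightarrow> F (\<phi> x) (\<psi> y) (\<psi> y'))"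
  shows "H \<in> PGR"
proof -
  obtain C where C: "\<And>k N E F. 2 \<le> k \<Longrightarrow> k ^ C \<le> N \<Longrightarrow> line_system N k E \<Longrightarrow> line_system N k F \<Longrightarrow>
     N ^ (p + q) \<le> k ^ C * card (solutions P p q N E F)"
    using P unfolding dense_def by blast
  \<comment> \<open>The summand \<open>C\<close> serves the density bound; the other two leave room
    for the lines of \<open>H\<close> without vertices, because \<open>k ^ C'\<close> exceeds
    \<open>C'\<close>.\<close>
  define C' where "C' = C + cols H + rows H"
  have "contains G H \<or> (\<exists>S. coclique G k S)"
    if k: "2 \<le> k" and G: "spanning_grid_subgraph (k ^ C') (k ^ C') G" for k G
  proof (rule disjCI)
    assume nc: "\<not> (\<exists>S. coclique G k S)"
    define N where "N = k ^ C'"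
    have G': "cols G = N" "rows G = N" "verts G = {1..N} \<times> {1..N}"
      using G by (auto simp: spanning_grid_subgraph_def complete_grid_def N_def)
    define E where "E y x x' \<longleftrightarrow> {(x, y), (x', y)} \<in> edges G \<and> x \<noteq> x'" for y x x' :: nat
    define F where "F x y y' \<longleftrightarrow> {(x, y), (x, y')} \<in> edges G \<and> y \<noteq> y'" for x y y' :: nat
    have E: "line_system N k E" unfolding line_system_def
    proof (intro conjI allI ballI impI)
      fix y S assume y: "y \<in> {1..N}" and S: "S \<subseteq> {1..N}" "card S = k"
      have "card ((\<lambda>x. (x, y)) ` S) = k" using S by (simp add: card_image inj_on_def)
      moreover have "\<not> coclique G k ((\<lambda>x. (x, y)) ` S)" using nc by blast
      ultimately show "\<exists>u\<in>S. \<exists>v\<in>S. E y u v"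
        using y S(1) unfolding coclique_def G' E_def by auto
    qed (auto simp: E_def insert_commute)
    have F: "line_system N k F" unfolding line_system_def
    proof (intro conjI allI ballI impI)
      fix x S assume x: "x \<in> {1..N}" and S: "S \<subseteq> {1..N}" "card S = k"
      have "card ((\<lambda>y. (x, y)) ` S) = k" using S by (simp add: card_image inj_on_def)
      moreover have "\<not> coclique G k ((\<lambda>y. (x, y)) ` S)" using nc by blast
      ultimately show "\<exists>u\<in>S. \<exists>v\<in>S. F x u v"
        using x S(1) unfolding coclique_def G' F_def by auto
    qed (auto simp: F_def insert_commute)
    have "k ^ C \<le> N" unfolding N_def C'_def using k by (intro power_increasing) auto
    then have "N ^ (p + q) \<le> k ^ C * card (solutions P p q N E F)" using C k E F by blast
    moreover have "0 < N ^ (p + q)" using k by (simp add: N_def)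
    ultimately have "solutions P p q N E F \<noteq> {}" by fastforce
    then obtain X Y where XY: "X \<in> lists_in N p" "Y \<in> lists_in N q" "P E F X Y"
      unfolding solutions_def by blast
    obtain \<phi> \<psi> where e: "inj_on \<phi> (fst ` verts H)" "\<phi> ` fst ` verts H \<subseteq> set X"
        "inj_on \<psi> (snd ` verts H)" "\<psi> ` snd ` verts H \<subseteq> set Y"
        "\<And>x x' y. {(x, y), (x', y)} \<in> edges H \<Longrightarrow> x \<noteq> x' \<Longrightarrow> E (\<psi> y) (\<phi> x) (\<phi> x')"
        "\<And>x y y'. {(x, y), (x, y')} \<in> edges H \<Longrightarrow> y \<noteq> y' \<Longrightarrow> F (\<phi> x) (\<psi> y) (\<psi> y')"
      using emb[OF line_system_sym[OF E] line_system_sym[OF F] _ _ XY(3)] XY(1,2)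
      unfolding lists_in_def by auto
    have N: "cols H \<le> N" "rows H \<le> N"
    proof -
      have "C' < N" unfolding N_def using k by (rule less_exp[THEN order_less_le_trans, OF power_mono]) simp
      then show "cols H \<le> N" "rows H \<le> N" by (auto simp: C'_def)
    qed
    have im: "\<phi> ` fst ` verts H \<subseteq> {1..N}" "\<psi> ` snd ` verts H \<subseteq> {1..N}"
      using e(2,4) XY(1,2) unfolding lists_in_def by blast+
    have sub: "fst ` verts H \<subseteq> {1..cols H}" "snd ` verts H \<subseteq> {1..rows H}"
      using H unfolding grid_subgraph_def by auto
    obtain \<phi>' where \<phi>': "inj_on \<phi>' {1..cols H}" "\<phi>' ` {1..cols H} \<subseteq> {1..N}"
      "\<And>x. x \<in> fst ` verts H \<Longrightarrow> \<phi>' x = \<phi> x"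
      by (rule inj_on_extend[of "{1..cols H}" "{1..N}" "fst ` verts H" \<phi>])
        (use sub e(1) im N in auto)
    obtain \<psi>' where \<psi>': "inj_on \<psi>' {1..rows H}" "\<psi>' ` {1..rows H} \<subseteq> {1..N}"
      "\<And>y. y \<in> snd ` verts H \<Longrightarrow> \<psi>' y = \<psi> y"
      by (rule inj_on_extend[of "{1..rows H}" "{1..N}" "snd ` verts H" \<psi>])
        (use sub e(3) im N in auto)
    have "{(\<phi>' x, \<psi>' y), (\<phi>' x', \<psi>' y')} \<in> edges G" if h: "{(x, y), (x', y')} \<in> edges H" for x y x' y'
    proof -
      obtain u v where uv: "u \<in> verts H" "v \<in> verts H" "u \<noteq> v" "{(x, y), (x', y')} = {u, v}" "same_line u v"
        using H h unfolding grid_subgraph_def by blast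
      then have V: "(x, y) \<in> verts H" "(x', y') \<in> verts H" and ne: "(x, y) \<noteq> (x', y')"
        and sl: "y = y' \<or> x = x'" unfolding same_line_def by (auto simp: doubleton_eq_iff)
      have "\<phi>' x = \<phi> x" "\<phi>' x' = \<phi> x'" "\<psi>' y = \<psi> y" "\<psi>' y' = \<psi> y'"
        using V \<phi>'(3) \<psi>'(3) by force+
      then show ?thesis using sl ne h e(5)[of x y x'] e(6)[of x y y'] by (auto simp: E_def F_def)
    qed
    then show "contains G H"
      unfolding contains_def embedding_def G' using \<phi>'(1,2) \<psi>'(1,2) by blast
  qed
  then have "grid_ramsey H k \<le> enat (k ^ C')" if "2 \<le> k" for k
    unfolding grid_ramsey_def using that by (intro Inf_lower) blast
  then have "ereal_of_enat (grid_ramsey H k) \<le> ereal (real k powr real C')" if "2 \<le> k" for k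
  proof -
    have "ereal_of_enat (grid_ramsey H k) \<le> ereal_of_enat (enat (k ^ C'))"
      using that \<open>\<And>k. 2 \<le> k \<Longrightarrow> grid_ramsey H k \<le> enat (k ^ C')\<close> by (simp only: ereal_of_enat_le_iff)
    also have "\<dots> = ereal (real k powr real C')" using that by (simp add: powr_realpow)
    finally show ?thesis .
  qed
  then show ?thesis using H unfolding PGR_def by blast
qed

subsection \<open>Simple cycles\<close>

fun steps :: "(nat \<times> nat) list \<Rightarrow> bool list" where
  "steps (u # v # us) = (snd u = snd v) # steps (v # us)"
| "steps _ = []"

lemma length_steps [simp]: "length (steps us) = length us - 1"
  by (induction us rule: steps.induct) auto

lemma nth_steps: "Suc i < length us \<Longrightarrow> steps us ! i \<longleftrightarrow> snd (us ! i) = snd (us ! Suc i)"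
  by (induction us arbitrary: i rule: steps.induct) (auto simp: nth_Cons' split: nat.splits)

definition proper_step :: "nat \<times> nat \<Rightarrow> nat \<times> nat \<Rightarrow> bool" where
  "proper_step u v \<longleftrightarrow> u \<noteq> v \<and> same_line u v"

text \<open>A proper step changes exactly one coordinate, so the compressed column list gains an
  entry exactly at the horizontal steps, and the row list at the vertical ones.\<close>

lemma length_remdups_adj_steps:
  assumes "successively proper_step us" and "us \<noteq> []"
  shows "length (remdups_adj (map fst us)) = Suc (count_list (steps us) True)"
    and "length (remdups_adj (map snd us)) = Suc (count_list (steps us) False)"
  using assms
  by (induction us rule: steps.induct) (auto simp: proper_step_def same_line_def prod_eq_iff)

definition adjacent_image where
  "adjacent_image E F \<phi> \<psi> u v \<longleftrightarrow>
     (if snd u = snd v then E (\<psi> (snd u)) (\<phi> (fst u)) (\<phi> (fst v))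
      else F (\<phi> (fst u)) (\<psi> (snd u)) (\<psi> (snd v)))"

text \<open>The compressed coordinate lists are consumed by \<open>walk\<close> in step with the
  vertices: their heads are always the coordinates of the current vertex.\<close>

lemma successively_of_walk_steps:
  fixes \<phi> \<psi> :: "nat \<Rightarrow> nat"
  assumes "successively proper_step us"
    and "walk E F (steps us) (map \<phi> (remdups_adj (map fst us))) (map \<psi> (remdups_adj (map snd us)))"
  shows "successively (adjacent_image E F \<phi> \<psi>) us"
  using assms
proof (induction us rule: steps.induct)
  case (1 u v us)
  have hd: "map f (remdups_adj (x # xs)) ! 0 = f x" for f :: "nat \<Rightarrow> nat" and x xs
    using hd_conv_nth[of "remdups_adj (x # xs)"] by simp
  show ?case
  proof (cases "snd u = snd v")
    case True
    then have "fst u \<noteq> fst v" using 1 by (auto simp: proper_step_def prod_eq_iff)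
    then show ?thesis using 1 True hd by (auto simp: adjacent_image_def)
  next
    case False
    then have "fst u = fst v" using 1 by (auto simp: proper_step_def same_line_def)
    then show ?thesis using 1 False hd by (auto simp: adjacent_image_def)
  qed
qed auto

text \<open>Compression preserves the first and last entries, which agree for a closed list. This
  gives the form \<open>X @ [hd X]\<close> of \<open>closed_walk\<close>.\<close>

lemma remdups_adj_closed:
  assumes "cs \<noteq> []" and "2 \<le> length (remdups_adj (map f (cs @ [hd cs])))"
  defines "L \<equiv> remdups_adj (map f (cs @ [hd cs]))"
  shows "L = butlast L @ [hd (butlast L)]"
proof -
  have l: "2 \<le> length L" using assms(2) by (simp only: L_def)
  then have "L \<noteq> []" by auto
  moreover have "butlast L \<noteq> []" using l length_butlast[of L] by (auto simp del: length_butlast)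
  moreover have "last L = f (hd cs)" "hd L = f (hd cs)"
    using assms(1) by (simp_all add: L_def hd_append hd_map)
  moreover have "hd (butlast L) = hd L" using \<open>butlast L \<noteq> []\<close> by (cases L) auto
  ultimately show ?thesis by (metis append_butlast_last_id)
qed

text \<open>The segment strictly between \<open>j1\<close> and \<open>j2\<close> can only be left through one of these positions.\<close>

lemma connected_fibre_no_alternation:
  fixes f :: "'a \<Rightarrow> 'b"
  defines "E cs \<equiv> {{cs ! i, cs ! (Suc i mod length cs)} |i. i < length cs}"
  assumes dist: "distinct cs"
    and conn: "connected_graph {v \<in> set cs. f v = c} {e \<in> E cs. e \<subseteq> {v \<in> set cs. f v = c}}"
    and j: "j1 < j2" "j2 < length cs" "f (cs ! j1) \<noteq> c" "f (cs ! j2) \<noteq> c"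
    and i: "j1 < i" "i < j2" "f (cs ! i) = c"
    and i': "i' < length cs" "i' < j1 \<or> j2 < i'" "f (cs ! i') = c"
  shows False
proof -
  let ?W = "{v \<in> set cs. f v = c}" and ?n = "length cs"
  have "(cs ! i, cs ! i') \<in> {(a, b). {a, b} \<in> {e \<in> E cs. e \<subseteq> ?W}}\<^sup>*"
  proof -
    have "cs ! i \<in> ?W" "cs ! i' \<in> ?W" using i i' j by simp_all
    then show ?thesis using conn unfolding connected_graph_def by blast
  qed
  then have "\<exists>m. j1 < m \<and> m < j2 \<and> cs ! i' = cs ! m"
  proof (induction rule: rtrancl_induct)
    case base
    then show ?case using i by blast
  next
    case (step a b)
    then obtain m where m: "j1 < m" "m < j2" "a = cs ! m" by blast
    have "{a, b} \<in> E cs" and b: "f b = c" using step(2) by simp_all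
    then obtain t where t: "t < ?n" "{a, b} = {cs ! t, cs ! (Suc t mod ?n)}"
      unfolding E_def by blast
    have n: "0 < ?n" using t by linarith
    from t(2) consider "cs ! m = cs ! t" "b = cs ! (Suc t mod ?n)" | "cs ! m = cs ! (Suc t mod ?n)" "b = cs ! t"
      unfolding doubleton_eq_iff m(3) by blast
    then show ?case
    proof cases
      case 1
      then have "m = t" using nth_eq_iff_index_eq[OF dist, of m t] m j t by simp
      then have "b = cs ! Suc m" using 1 m j by simp
      moreover have "Suc m \<noteq> j2" using calculation b j by auto
      ultimately show ?thesis using m by (intro exI[of _ "Suc m"]) auto
    next
      case 2
      then have mt: "m = Suc t mod ?n"
        using nth_eq_iff_index_eq[OF dist, of m "Suc t mod ?n"] m j n by simp
      \<comment> \<open>The edge from the last position back to position 0 is excluded, as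
        \<open>m\<close> exceeds \<open>j1\<close>.\<close>
      have "m = Suc t"
      proof (cases "Suc t = ?n")
        case True
        then show ?thesis using mt m by simp
      next
        case False
        then show ?thesis using mt t(1) by simp
      qed
      moreover have "t \<noteq> j1" using 2 b j by auto
      ultimately show ?thesis using m 2 by (intro exI[of _ t]) auto
    qed
  qed
  then obtain m where m: "j1 < m" "m < j2" "cs ! i' = cs ! m" by blast
  then have "i' = m" using nth_eq_iff_index_eq[OF dist, of i' m] i' j by simp
  then show False using m i'(2) by simp
qed

text \<open>If the value \<open>c\<close> stood at entries \<open>a < b\<close>, the entries
  \<open>Suc a\<close> and \<open>Suc b\<close> would differ from it. The corresponding positions
  would cut the cycle into two arcs that both meet the fibre of \<open>c\<close>, against its
  connectedness.\<close>

lemma distinct_butlast_remdups_adj: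
  fixes f :: "'a \<Rightarrow> 'b"
  defines "E cs \<equiv> {{cs ! i, cs ! (Suc i mod length cs)} |i. i < length cs}"
  assumes dist: "distinct cs" and ne: "cs \<noteq> []"
    and conn: "\<And>c. c \<in> f ` set cs \<Longrightarrow>
      connected_graph {v \<in> set cs. f v = c} {e \<in> E cs. e \<subseteq> {v \<in> set cs. f v = c}}"
  shows "distinct (butlast (remdups_adj (map f (cs @ [hd cs]))))"
proof (rule ccontr)
  define xs L where "xs = map f (cs @ [hd cs])" and "L = remdups_adj xs"
  assume "\<not> distinct (butlast (remdups_adj (map f (cs @ [hd cs]))))"
  then obtain a b where "a < b" "Suc b < length L" "L ! a = L ! b"
    by (fastforce simp: distinct_conv_nth L_def xs_def nth_butlast less_diff_conv nat_neq_iff)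
  note ab = this
  define c where "c = L ! a"
  have La: "L ! Suc a \<noteq> c" "L ! Suc b \<noteq> c"
    using ab remdups_adj_adjacent[of a xs] remdups_adj_adjacent[of b xs] by (auto simp: L_def c_def)
  have ab': "Suc a < b" using ab La by (metis Suc_lessI c_def)
  \<comment> \<open>\<open>g\<close> sends each position of the uncompressed list to its entry in
    \<open>L\<close>; preimages under it turn entries back into positions on the cycle.\<close>
  obtain g where g: "mono g" "g ` {0..<length xs} = {0..<length L}" "\<And>i. i < length xs \<Longrightarrow> xs ! i = L ! g i"
    using remdups_adj_altdef[of xs L] L_def by blast
  have ex: "\<exists>i<length xs. g i = m" if "m < length L" for m
    using g(2) that by (metis atLeast0LessThan imageE lessThan_iff)
  obtain ia ia1 ib ib1 where
    ia: "ia < length xs" "g ia = a" and ia1: "ia1 < length xs" "g ia1 = Suc a" and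
    ib: "ib < length xs" "g ib = b" and ib1: "ib1 < length xs" "g ib1 = Suc b"
    using ex[of a] ex[of "Suc a"] ex[of b] ex[of "Suc b"] ab by auto
  have less: "i < j" if "g i < g j" for i j using g(1) that by (meson linorder_not_less monoD)
  have ord: "ia < ia1" "ia1 < ib" "ib < ib1" using ia ia1 ib ib1 ab ab' by (auto intro: less)
  have nth: "xs ! i = f (cs ! i)" if "i < length cs" for i using that by (simp add: xs_def nth_append)
  have last: "xs ! length cs = f (cs ! 0)" using ne by (simp add: xs_def nth_append hd_conv_nth)
  have len: "length xs = Suc (length cs)" by (simp add: xs_def)
  have f: "f (cs ! ia) = c" "f (cs ! ia1) \<noteq> c" "f (cs ! ib) = c"
    using g(3)[of ia] g(3)[of ia1] g(3)[of ib] ia ia1 ib ord ib1 len nth La ab by (auto simp: c_def)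
  have "ia < length cs" using ord ib1 len by linarith
  then have conn': "connected_graph {v \<in> set cs. f v = c} {e \<in> E cs. e \<subseteq> {v \<in> set cs. f v = c}}"
    using conn f(1) by force
  note no_alt = connected_fibre_no_alternation[OF dist conn'[unfolded E_def]]
  show False
  proof (cases "ib1 = length cs")
    case False
    then have "ib1 < length cs" using ib1 len by simp
    moreover have "f (cs ! ib1) \<noteq> c" using calculation g(3)[OF ib1(1)] ib1 nth La by simp
    ultimately show False using no_alt[of ia1 ib1 ib ia] ord f by simp
  next
    case True
    \<comment> \<open>The entry after \<open>b\<close> is the closing copy of position 0, so
      position 0 takes over as a separating point.\<close>
    then have 0: "f (cs ! 0) \<noteq> c" using g(3)[OF ib1(1)] ib1 last La by simp
    then have "0 < ia" using f by (metis gr0I)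
    then show False using no_alt[of 0 ia1 ia ib] ord f 0 True by simp
  qed
qed

lemma ex_map_eq:
  assumes "distinct xs" and "length ys = length xs"
  obtains \<phi> where "map \<phi> xs = ys"
proof
  show "map (the \<circ> map_of (zip xs ys)) xs = ys"
    using assms by (intro nth_equalityI) (auto simp: map_of_zip_nth)
qed

lemma sorted_wrt_symD:
  assumes "sorted_wrt R X" and "\<And>u v. R u v \<Longrightarrow> R v u" and "x \<in> set X" and "y \<in> set X" and "x \<noteq> y"
  shows "R x y"
  using assms(1,3-5)
proof (induction X)
  case (Cons a X)
  then show ?case using assms(2) by auto
qed simp

section \<open>Embedding a simple cycle along its word\<close>

locale simple_cycle_list =
  fixes H :: grid_graph and cs :: "(nat \<times> nat) list"
  assumes grid: "grid_subgraph H" and dist: "distinct cs" and len: "5 \<le> length cs"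
    and verts: "verts H = set cs"
    and edges: "edges H = {{cs ! i, cs ! (Suc i mod length cs)} |i. i < length cs}"
    and simple: "simple_grid H"
begin

abbreviation "us \<equiv> cs @ [hd cs]"

lemma ne: "cs \<noteq> []" using len by auto

lemma us_nth: "i < length cs \<Longrightarrow> us ! i = cs ! i"
  "i < length cs \<Longrightarrow> us ! Suc i = cs ! (Suc i mod length cs)"
  using ne by (auto simp: nth_append hd_conv_nth mod_Suc)

lemma edgeE:
  assumes "{u, v} \<in> edges H"
  obtains i where "i < length cs" and "{u, v} = {us ! i, us ! Suc i}"
  using assms us_nth by (auto simp: edges)

lemma proper: "successively proper_step us"
  unfolding successively_conv_nth
proof (intro allI impI)
  fix i assume "Suc i < length us"
  then have i: "i < length cs" by simp
  then have "{us ! i, us ! Suc i} \<in> edges H" using us_nth by (auto simp: edges)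
  then obtain u v where "u \<noteq> v" "{us ! i, us ! Suc i} = {u, v}" "same_line u v"
    using grid unfolding grid_subgraph_def by blast
  then show "proper_step (us ! i) (us ! Suc i)"
    by (auto simp: proper_step_def same_line_def doubleton_eq_iff)
qed

text \<open>Simplicity enters here: the cycle visits no line in two separate runs.\<close>

lemma distinct_lines:
  "distinct (butlast (remdups_adj (map fst us)))" "distinct (butlast (remdups_adj (map snd us)))"
proof -
  have sub: "set cs \<subseteq> {1..cols H} \<times> {1..rows H}" using grid verts by (simp add: grid_subgraph_def)
  show "distinct (butlast (remdups_adj (map fst us)))"
  proof (rule distinct_butlast_remdups_adj[OF dist ne])
    fix c assume "c \<in> fst ` set cs"
    then have "c \<in> {1..cols H}" using sub by auto
    then show "connected_graph {v \<in> set cs. fst v = c} {e \<in> {{cs ! i, cs ! (Suc i mod length cs)} |i. i < length cs}. e \<subseteq> {v \<in> set cs. fst v = c}}"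
      using simple unfolding simple_grid_def induced_edges_def verts edges by (simp add: Let_def)
  qed
  show "distinct (butlast (remdups_adj (map snd us)))"
  proof (rule distinct_butlast_remdups_adj[OF dist ne])
    fix c assume "c \<in> snd ` set cs"
    then have "c \<in> {1..rows H}" using sub by auto
    then show "connected_graph {v \<in> set cs. snd v = c} {e \<in> {{cs ! i, cs ! (Suc i mod length cs)} |i. i < length cs}. e \<subseteq> {v \<in> set cs. snd v = c}}"
      using simple unfolding simple_grid_def induced_edges_def verts edges by (simp add: Let_def)
  qed
qed

text \<open>The lines of the cycle, in order of visit, are matched with the lists \<open>X\<close>
  and \<open>Y\<close> of a closed walk along its word. This matching is the embedding.\<close>

lemma PGR_if_alternating:
  assumes "subseq [h, \<not> h, h, \<not> h] (steps us)"
  shows "H \<in> PGR"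
proof -
  let ?w = "steps us"
  define L M where "L = remdups_adj (map fst us)" and "M = remdups_adj (map snd us)"
  have "2 \<le> count_list ?w True" "2 \<le> count_list ?w False"
    using count_list_subseq_le[OF assms, of True] count_list_subseq_le[OF assms, of False] by (cases h; simp)+
  then have l: "length L = Suc (hsteps ?w)" "length M = Suc (vsteps ?w)" "2 \<le> length L" "2 \<le> length M"
    using length_remdups_adj_steps[OF proper] by (auto simp: L_def M_def)
  have L: "L = butlast L @ [hd (butlast L)]" and M: "M = butlast M @ [hd (butlast M)]"
    using remdups_adj_closed[OF ne, of fst] remdups_adj_closed[OF ne, of snd] l unfolding L_def M_def by blast+
  have nb: "butlast L \<noteq> []" "butlast M \<noteq> []"
    using l length_butlast[of L] length_butlast[of M] by (auto simp del: length_butlast)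
  have set: "set (butlast L) = fst ` set cs" "set (butlast M) = snd ` set cs"
  proof -
    have "set L = fst ` set cs" "set M = snd ` set cs" using ne by (auto simp: L_def M_def)
    moreover have "set L = set (butlast L)" "set M = set (butlast M)"
      using L M nb by (metis Un_insert_right hd_in_set insert_absorb list.simps(15) set_append sup_bot_right empty_set)+
    ultimately show "set (butlast L) = fst ` set cs" "set (butlast M) = snd ` set cs" by auto
  qed
  have "dense_word ?w" using dense_word_of_alternating'[OF assms] len by simp
  then show ?thesis unfolding dense_word_def
  proof (rule PGR_of_dense[OF grid])
    fix E F :: "nat \<Rightarrow> nat \<Rightarrow> nat \<Rightarrow> bool" and X Y
    assume symE: "\<And>y u v. E y u v \<Longrightarrow> E y v u" and symF: "\<And>y u v. F y u v \<Longrightarrow> F y v u"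
      and lX: "length X = hsteps ?w" and lY: "length Y = vsteps ?w" and cl: "closed_walk ?w E F X Y"
    obtain \<phi> where \<phi>: "map \<phi> (butlast L) = X"
      using ex_map_eq[of "butlast L" X] distinct_lines lX l L_def by auto
    obtain \<psi> where \<psi>: "map \<psi> (butlast M) = Y"
      using ex_map_eq[of "butlast M" Y] distinct_lines lY l M_def by auto
    have "map \<phi> L = X @ [hd X]" "map \<psi> M = Y @ [hd Y]"
      using arg_cong[OF L, of "map \<phi>"] arg_cong[OF M, of "map \<psi>"] nb
      unfolding \<phi>[symmetric] \<psi>[symmetric] by (simp_all add: hd_map)
    then have "walk E F ?w (map \<phi> L) (map \<psi> M)" using cl by (simp add: closed_walk_def)
    then have suc: "successively (adjacent_image E F \<phi> \<psi>) us"
      using successively_of_walk_steps[OF proper] by (simp add: L_def M_def)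
    \<comment> \<open>An edge of \<open>H\<close> is unordered while the walk is directed; the
      symmetry of \<open>E\<close> and \<open>F\<close> makes up for this.\<close>
    have adj: "adjacent_image E F \<phi> \<psi> u v \<or> adjacent_image E F \<phi> \<psi> v u" if "{u, v} \<in> edges H" for u v
    proof -
      from that obtain i where "i < length cs" "{u, v} = {us ! i, us ! Suc i}" by (rule edgeE)
      then show ?thesis using suc unfolding successively_conv_nth by (auto simp: doubleton_eq_iff)
    qed
    show "\<exists>\<phi> \<psi>. inj_on \<phi> (fst ` verts H) \<and> \<phi> ` fst ` verts H \<subseteq> set X \<and>
        inj_on \<psi> (snd ` verts H) \<and> \<psi> ` snd ` verts H \<subseteq> set Y \<and>
        (\<forall>x x' y. {(x, y), (x', y)} \<in> edges H \<longrightarrow> x \<noteq> x' \<longrightarrow> E (\<psi> y) (\<phi> x) (\<phi> x')) \<and>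
        (\<forall>x y y'. {(x, y), (x, y')} \<in> edges H \<longrightarrow> y \<noteq> y' \<longrightarrow> F (\<phi> x) (\<psi> y) (\<psi> y'))"
    proof (rule exI[of _ \<phi>], rule exI[of _ \<psi>], intro conjI allI impI)
      have "distinct X" "distinct Y" using cl by (auto simp: closed_walk_def)
      then show "inj_on \<phi> (fst ` verts H)" "inj_on \<psi> (snd ` verts H)"
        using \<phi> \<psi> set verts by (auto simp: distinct_map)
      show "\<phi> ` fst ` verts H \<subseteq> set X" "\<psi> ` snd ` verts H \<subseteq> set Y"
        using set unfolding \<phi>[symmetric] \<psi>[symmetric] verts set_map by simp_all
      show "E (\<psi> y) (\<phi> x) (\<phi> x')" if "{(x, y), (x', y)} \<in> edges H" for x x' y
        using adj[OF that] symE by (auto simp: adjacent_image_def)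
      show "F (\<phi> x) (\<psi> y) (\<psi> y')" if "{(x, y), (x, y')} \<in> edges H" "y \<noteq> y'" for x y y'
        using adj[OF that(1)] that(2) symF by (auto simp: adjacent_image_def split: if_splits)
    qed
  qed
qed

lemma edge_in_verts: "{u, v} \<in> edges H \<Longrightarrow> u \<in> set cs \<and> v \<in> set cs"
  using grid unfolding grid_subgraph_def verts by (metis doubleton_eq_iff)

text \<open>A clique on \<open>length cs\<close> columns within one row contains every cycle with
  that many vertices.\<close>

lemma PGR_if_one_row:
  assumes "\<And>v. v \<in> set cs \<Longrightarrow> snd v = y0"
  shows "H \<in> PGR"
proof (rule PGR_of_dense[OF grid dense_clique[of "length cs - 1"]])
  fix E F :: "nat \<Rightarrow> nat \<Rightarrow> nat \<Rightarrow> bool" and X Y :: "nat list"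
  assume symE: "\<And>y u v. E y u v \<Longrightarrow> E y v u"
    and l: "length X = Suc (length cs - 1)" "length Y = 1" and c: "sorted_wrt (E (Y ! 0)) X \<and> distinct X"
  have d: "distinct (map fst cs)"
    using dist assms by (auto simp: distinct_map inj_on_def prod_eq_iff)
  obtain \<phi> where \<phi>: "map \<phi> (map fst cs) = X" using ex_map_eq[OF d] l(1) ne by auto
  have setX: "set X = \<phi> ` fst ` verts H" unfolding \<phi>[symmetric] verts by (simp add: image_image)
  have inj: "inj_on \<phi> (fst ` verts H)" using c verts unfolding \<phi>[symmetric] by (simp add: distinct_map inj_on_imageI)
  show "\<exists>\<phi> \<psi>. inj_on \<phi> (fst ` verts H) \<and> \<phi> ` fst ` verts H \<subseteq> set X \<and>
        inj_on \<psi> (snd ` verts H) \<and> \<psi> ` snd ` verts H \<subseteq> set Y \<and>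
        (\<forall>x x' y. {(x, y), (x', y)} \<in> edges H \<longrightarrow> x \<noteq> x' \<longrightarrow> E (\<psi> y) (\<phi> x) (\<phi> x')) \<and>
        (\<forall>x y y'. {(x, y), (x, y')} \<in> edges H \<longrightarrow> y \<noteq> y' \<longrightarrow> F (\<phi> x) (\<psi> y) (\<psi> y'))"
  proof (rule exI[of _ \<phi>], rule exI[of _ "\<lambda>_. Y ! 0"], intro conjI allI impI)
    show "\<phi> ` fst ` verts H \<subseteq> set X" by (simp add: setX)
    show "inj_on (\<lambda>_. Y ! 0) (snd ` verts H)" using assms by (auto simp: verts inj_on_def)
    show "(\<lambda>_. Y ! 0) ` snd ` verts H \<subseteq> set Y" using l(2) by auto
    fix x x' y y'
    show "E (Y ! 0) (\<phi> x) (\<phi> x')" if "{(x, y), (x', y)} \<in> edges H" "x \<noteq> x'"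
    proof (rule sorted_wrt_symD[where R = "E (Y ! 0)"])
      have "x \<in> fst ` set cs" "x' \<in> fst ` set cs" using edge_in_verts[OF that(1)] by force+
      then show "\<phi> x \<in> set X" "\<phi> x' \<in> set X" "\<phi> x \<noteq> \<phi> x'"
        using inj that(2) unfolding setX verts by (simp_all add: inj_on_eq_iff)
    qed (use c symE in auto)
    show "F (\<phi> x) (Y ! 0) (Y ! 0)" if "{(x, y), (x, y')} \<in> edges H" "y \<noteq> y'"
      using edge_in_verts[OF that(1)] assms[of "(x, y)"] assms[of "(x, y')"] that(2) by simp
  qed (rule inj)
qed

lemma PGR_if_one_column:
  assumes "\<And>v. v \<in> set cs \<Longrightarrow> fst v = x0"
  shows "H \<in> PGR"
proof (rule PGR_of_dense[OF grid dense_swap[OF dense_clique[of "length cs - 1"]]])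
  fix E F :: "nat \<Rightarrow> nat \<Rightarrow> nat \<Rightarrow> bool" and X Y :: "nat list"
  assume symF: "\<And>y u v. F y u v \<Longrightarrow> F y v u"
    and l: "length Y = Suc (length cs - 1)" "length X = 1" and c: "sorted_wrt (F (X ! 0)) Y \<and> distinct Y"
  have d: "distinct (map snd cs)"
    using dist assms by (auto simp: distinct_map inj_on_def prod_eq_iff)
  obtain \<psi> where \<psi>: "map \<psi> (map snd cs) = Y" using ex_map_eq[OF d] l(1) ne by auto
  have setY: "set Y = \<psi> ` snd ` verts H" unfolding \<psi>[symmetric] verts by (simp add: image_image)
  have inj: "inj_on \<psi> (snd ` verts H)" using c verts unfolding \<psi>[symmetric] by (simp add: distinct_map inj_on_imageI)
  show "\<exists>\<phi> \<psi>. inj_on \<phi> (fst ` verts H) \<and> \<phi> ` fst ` verts H \<subseteq> set X \<and>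
        inj_on \<psi> (snd ` verts H) \<and> \<psi> ` snd ` verts H \<subseteq> set Y \<and>
        (\<forall>x x' y. {(x, y), (x', y)} \<in> edges H \<longrightarrow> x \<noteq> x' \<longrightarrow> E (\<psi> y) (\<phi> x) (\<phi> x')) \<and>
        (\<forall>x y y'. {(x, y), (x, y')} \<in> edges H \<longrightarrow> y \<noteq> y' \<longrightarrow> F (\<phi> x) (\<psi> y) (\<psi> y'))"
  proof (rule exI[of _ "\<lambda>_. X ! 0"], rule exI[of _ \<psi>], intro conjI allI impI)
    show "\<psi> ` snd ` verts H \<subseteq> set Y" by (simp add: setY)
    show "inj_on (\<lambda>_. X ! 0) (fst ` verts H)" using assms by (auto simp: verts inj_on_def)
    show "(\<lambda>_. X ! 0) ` fst ` verts H \<subseteq> set X" using l(2) by auto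
    fix x x' y y'
    show "F (X ! 0) (\<psi> y) (\<psi> y')" if "{(x, y), (x, y')} \<in> edges H" "y \<noteq> y'"
    proof (rule sorted_wrt_symD[where R = "F (X ! 0)"])
      have "y \<in> snd ` set cs" "y' \<in> snd ` set cs" using edge_in_verts[OF that(1)] by force+
      then show "\<psi> y \<in> set Y" "\<psi> y' \<in> set Y" "\<psi> y \<noteq> \<psi> y'"
        using inj that(2) unfolding setY verts by (simp_all add: inj_on_eq_iff)
    qed (use c symF in auto)
    show "E (\<psi> y) (X ! 0) (X ! 0)" if "{(x, y), (x', y)} \<in> edges H" "x \<noteq> x'"
      using edge_in_verts[OF that(1)] assms[of "(x, y)"] assms[of "(x', y)"] that(2) by simp
  qed (rule inj)
qed

text \<open>With at most three runs, the vertices at both ends of the middle run agree in one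
  coordinate along that run and in the other along the two outer runs, which meet at the starting
  vertex. So the middle run is empty or everything, and the cycle lies in one line.\<close>

lemma PGR: "H \<in> PGR"
proof (cases rule: alternating_or_three_runs[of "steps us"])
  case (1 h)
  then show ?thesis by (rule PGR_if_alternating)
next
  case (2 h a b c)
  \<comment> \<open>The coordinate that a step of kind \<open>l\<close> leaves fixed.\<close>
  define coord where "coord l = (if l then snd else fst :: nat \<times> nat \<Rightarrow> nat)" for l :: bool
  let ?n = "length cs"
  have n: "?n = a + b + c" using arg_cong[OF 2, of length] by simp
  have coord_step: "coord (steps us ! m) (us ! m) = coord (steps us ! m) (us ! Suc m)" if "m < ?n" for m
  proof -
    have "proper_step (us ! m) (us ! Suc m)" using proper that unfolding successively_conv_nth by simp
    then show ?thesis using nth_steps[of m us] that by (auto simp: coord_def proper_step_def same_line_def)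
  qed
  have run: "coord l (us ! i) = coord l (us ! j)"
    if "i \<le> j" "j \<le> ?n" "\<And>m. i \<le> m \<Longrightarrow> m < j \<Longrightarrow> steps us ! m = l" for l i j
    using that
  proof (induction j rule: dec_induct)
    case (step j)
    then have "coord l (us ! i) = coord l (us ! j)" "steps us ! j = l" by auto
    then show ?case using coord_step[of j] step.prems by simp
  qed simp
  have 0: "us ! 0 = us ! ?n" using ne by (simp add: nth_append hd_conv_nth)
  have "coord h (us ! 0) = coord h (us ! a)" "coord (\<not> h) (us ! a) = coord (\<not> h) (us ! (a + b))"
    "coord h (us ! (a + b)) = coord h (us ! ?n)"
    using n by (intro run; auto simp: 2 nth_append)+
  then have "us ! a = us ! (a + b)" using 0 by (cases h) (auto simp: coord_def prod_eq_iff)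
  note eq = this
  \<comment> \<open>Distinctness holds for \<open>cs\<close> only: the index \<open>?n\<close> of
    \<open>us\<close> denotes the starting vertex again and is treated apart.\<close>
  have "b = 0 \<or> b = ?n"
  proof (cases "a + b < ?n")
    case True
    then show ?thesis using eq dist us_nth(1)[of a] us_nth(1)[of "a + b"] by (simp add: nth_eq_iff_index_eq)
  next
    case False
    then have ab: "a + b = ?n" using n by simp
    show ?thesis
    proof (cases "a = ?n")
      case False
      then have "cs ! a = cs ! 0"
        using eq 0 us_nth(1)[of a] us_nth(1)[of 0] ab ne by auto
      then have "a = 0" using dist False ab ne by (simp add: nth_eq_iff_index_eq)
      then show ?thesis using ab by simp
    qed (use ab in simp)
  qed
  then obtain l where l: "\<And>m. m < ?n \<Longrightarrow> steps us ! m = l"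
  proof
    assume "b = 0"
    then have "steps us = replicate ?n h" using 2 n by (simp add: replicate_add)
    then show thesis using that by simp
  next
    assume "b = ?n"
    then have "steps us = replicate ?n (\<not> h)" using 2 n by simp
    then show thesis using that by simp
  qed
  have line: "coord l v = coord l (us ! 0)" if "v \<in> set cs" for v
  proof -
    obtain i where i: "i < ?n" "v = cs ! i" using \<open>v \<in> set cs\<close> by (auto simp: in_set_conv_nth)
    have "coord l (us ! 0) = coord l (us ! i)" using i l by (intro run) auto
    then show ?thesis using i us_nth(1) by simp
  qed
  show ?thesis
  proof (cases l)
    case True
    show ?thesis by (rule PGR_if_one_row) (use line True in \<open>simp add: coord_def\<close>)
  next
    case False
    show ?thesis by (rule PGR_if_one_column) (use line False in \<open>simp add: coord_def\<close>)
  qed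
qed

end

theorem theorem1p1:
  fixes H :: grid_graph
  assumes "simple_cycle H" and "card (verts H) \<ge> 5"
  shows "H \<in> PGR"
proof -
  obtain cs where "distinct cs" "verts H = set cs"
    "edges H = {{cs ! i, cs ! (Suc i mod length cs)} |i. i < length cs}"
    using assms(1) unfolding simple_cycle_def cycle_graph_def by blast
  then have "simple_cycle_list H cs"
    using assms unfolding simple_cycle_def by unfold_locales (auto simp: distinct_card)
  then show ?thesis by (rule simple_cycle_list.PGR)
qed

end
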